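(* Let $N\ge2$. For $c>1$ and $\mathrm{Re}(s)>N+c$ we have $$D_{N+1}(s)=\frac1{2\pi\sqrt{-1}}\,\frac1{\Gamma(s)}\int_{\Lambda_c}D_N(s-\tau)\,\Gamma(s-\tau)\,\Gamma(\tau)\,\zeta(\tau)\,d\tau,$$ where $\Lambda_c=\{c+\sqrt{-1}\,t:t\in\mathbb R\}$.
   Context: $\zeta$ is the Riemann zeta function. For $m\ge2$, $p_1(m)$ is the smallest prime divisor of $m$. For $2\le N\le n$, $A(n,N)$ (a Cyrillic "el" in the paper) is the number of compositions $(\lambda_1,\dots,\lambda_N)\in\mathbb Z_{>0}^N$ with $\lambda_1+\dots+\lambda_N=n$ and $\min\{\lambda_1,\lambda_2\}<p_1(\lambda_1+\lambda_2)$; it is the number of partial flag varieties $F_{\boldsymbol\lambda}$ of $N$-step flags in $\mathbb C^n$ whose first semiclassical spectrum is not exceeding (one gets the same number using $(\lambda_i,\lambda_{i+1})$ for any fixed $i\le N-1$). For $N\ge2$, $D_N(s)=\sum_{n=N}^\infty A(n,N)n^{-s}$, absolutely convergent for $\mathrm{Re}(s)>N$. *)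

theory Defs
  imports "HOL-Analysis.Analysis" "HOL-Computational_Algebra.Primes"
begin

definition smallest_prime_divisor :: "nat \<Rightarrow> nat" where
  "smallest_prime_divisor m = (LEAST p. prime p \<and> p dvd m)"

text \<open>Compositions of \<open>n\<close> with \<open>N \<ge> 2\<close> parts whose first two parts satisfy
  \<open>min \<lambda>\<^sub>1 \<lambda>\<^sub>2 < p\<^sub>1(\<lambda>\<^sub>1 + \<lambda>\<^sub>2)\<close>; lists are indexed from 0.\<close>

definition not_exceeding_compositions :: "nat \<Rightarrow> nat \<Rightarrow> nat list set" where
  "not_exceeding_compositions n N =
     {xs. length xs = N \<and> (\<forall>x\<in>set xs. 0 < x) \<and> sum_list xs = n \<and>
          min (xs ! 0) (xs ! 1) < smallest_prime_divisor (xs ! 0 + xs ! 1)}"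

definition A :: "nat \<Rightarrow> nat \<Rightarrow> nat" where
  "A n N = card (not_exceeding_compositions n N)"

text \<open>Meaningful for \<open>Re s > N\<close>, where the series converges absolutely.\<close>

definition D :: "nat \<Rightarrow> complex \<Rightarrow> complex" where
  "D N s = (\<Sum>\<^sub>\<infinity>n\<in>{N..}. of_nat (A n N) * of_nat n powr (- s))"

text \<open>The Riemann zeta function by its defining Dirichlet series. No analytic continuation is
  built in, so this is \<open>\<zeta>(s)\<close> only in the half-plane \<open>Re s > 1\<close>.\<close>

definition zeta :: "complex \<Rightarrow> complex" where
  "zeta s = (\<Sum>\<^sub>\<infinity>n\<in>{1::nat..}. of_nat n powr (- s))"

text \<open>Integration over the upward vertical line parametrised by \<open>\<tau> = c + \<i> t\<close>, so that
  \<open>d\<tau> = \<i> dt\<close>, as an absolutely convergent Lebesgue integral.\<close>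

definition vline_integrable :: "real \<Rightarrow> (complex \<Rightarrow> complex) \<Rightarrow> bool" where
  "vline_integrable c f \<longleftrightarrow>
     integrable lborel (\<lambda>t::real. f (of_real c + \<i> * of_real t) * \<i>)"

definition vline_integral :: "real \<Rightarrow> (complex \<Rightarrow> complex) \<Rightarrow> complex" where
  "vline_integral c f =
     integral\<^sup>L lborel (\<lambda>t::real. f (of_real c + \<i> * of_real t) * \<i>)"

end

theory Submission
  imports Defs "HOL-Probability.Characteristic_Functions" "HOL-Probability.Sinc_Integral"
begin

text \<open>
  The condition on a composition concerns only its first two parts, so a composition with
  \<open>N + 1\<close> parts is a composition of some \<open>m\<close> with \<open>N\<close> parts followed by an arbitrary part
  \<open>k \<ge> 1\<close>. Hence \<open>D (N + 1) s\<close> is the sum of \<open>A m N * (m + k)\<^bsup>- s\<^esup>\<close> over all \<open>m \<ge> N\<close> and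
  \<open>k \<ge> 1\<close> (\<open>D_Suc_eq_double_sum\<close>).

  The Mellin--Barnes formula (\<open>Mellin_Barnes_integral\<close>) separates the two variables:
  \<open>\<Gamma> (s) (m + k)\<^bsup>- s\<^esup>\<close> is \<open>1 / (2 \<pi> \<i>)\<close> times the integral of
  \<open>\<Gamma> (s - \<tau>) m\<^bsup>- (s - \<tau>)\<^esup> \<Gamma> (\<tau>) k\<^bsup>- \<tau>\<^esup>\<close> over the vertical line \<open>Re \<tau> = c\<close>.
  Summing under the integral sign (\<open>has_bochner_integral_infsum\<close>), the sum over \<open>m\<close> gives
  \<open>D N (s - \<tau>)\<close> and the sum over \<open>k\<close> gives \<open>\<zeta> (\<tau>)\<close>. The exchange is justified by absolute
  convergence: the modulus of a summand is at most \<open>\<Gamma> (Re s - c) |\<Gamma> (\<tau>)|\<close>, which is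
  integrable along the line (\<open>integrable_Gamma_vertical\<close>), times
  \<open>A m N * m\<^bsup>- (Re s - c)\<^esup> k\<^bsup>- c\<^esup>\<close>, which is summable (\<open>summable_on_majorant\<close>) because
  \<open>A m N \<le> m\<^bsup>N - 1\<^esup>\<close>, \<open>Re s - c > N\<close> and \<open>c > 1\<close>.

  The Mellin--Barnes formula itself follows from Fubini's theorem and the inverse Mellin
  transform of \<open>\<Gamma>\<close> (\<open>Cahen_Mellin\<close>). In the logarithmic variable \<open>u = ln x\<close> Euler's integral is a
  Fourier integral, so this inverse transform is an instance of Fourier inversion
  (\<open>Fourier_inversion\<close>).
\<close>

section \<open>Compositions with an additional last part\<close>

lemma A_eq_0:
  assumes "n < N"
  shows "A n N = 0"
proof -
  have "length xs \<le> sum_list xs" if "\<forall>x\<in>set xs. 0 < x" for xs :: "nat list"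
    using that by (induction xs) auto
  then have "not_exceeding_compositions n N = {}"
    using assms by (fastforce simp: not_exceeding_compositions_def)
  then show ?thesis by (simp add: A_def)
qed

lemma finite_compositions: "finite (not_exceeding_compositions n N)"
proof (rule finite_subset)
  show "not_exceeding_compositions n N \<subseteq> {xs. set xs \<subseteq> {..n} \<and> length xs = N}"
    by (auto simp: not_exceeding_compositions_def intro: member_le_sum_list)
  show "finite {xs. set xs \<subseteq> {..n} \<and> length xs = N}"
    by (rule finite_lists_length_eq) simp
qed

text \<open>
  For \<open>N \<ge> 2\<close> the condition on a composition sees only its first two parts, so the last of
  \<open>N + 1\<close> parts is free. It is \<open>n - m\<close>, where \<open>m\<close> is the sum of the other parts.
\<close>

lemma compositions_Suc:
  assumes N: "2 \<le> N"
  shows "not_exceeding_compositions n (Suc N)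
    = (\<Union>m<n. (\<lambda>xs. xs @ [n - m]) ` not_exceeding_compositions m N)" (is "?L = ?R")
proof (intro equalityI subsetI)
  fix ys assume ys: "ys \<in> ?L"
  then have "ys \<noteq> []" by (auto simp: not_exceeding_compositions_def)
  then obtain xs k where yx: "ys = xs @ [k]" by (metis rev_exhaust)
  have "0 < k" "sum_list xs + k = n" "length xs = N" using ys
    by (auto simp: not_exceeding_compositions_def yx)
  moreover from this have "xs \<in> not_exceeding_compositions (sum_list xs) N"
    using ys N by (auto simp: not_exceeding_compositions_def yx nth_append)
  ultimately show "ys \<in> ?R"
    by (auto simp: yx intro!: bexI [of _ "sum_list xs"] image_eqI [of _ _ xs])
next
  fix ys assume "ys \<in> ?R"
  then show "ys \<in> ?L"
    using N by (auto simp: not_exceeding_compositions_def nth_append)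
qed

lemma A_Suc:
  assumes N: "2 \<le> N"
  shows "A n (Suc N) = (\<Sum>m<n. A m N)"
proof -
  have "A n (Suc N) = (\<Sum>m<n. card ((\<lambda>xs. xs @ [n - m]) ` not_exceeding_compositions m N))"
    unfolding A_def compositions_Suc [OF N]
  proof (rule card_UN_disjoint)
    show "\<forall>m\<in>{..<n}. \<forall>k\<in>{..<n}. m \<noteq> k \<longrightarrow>
        (\<lambda>xs. xs @ [n - m]) ` not_exceeding_compositions m N \<inter>
        (\<lambda>xs. xs @ [n - k]) ` not_exceeding_compositions k N = {}"
      by (auto simp: not_exceeding_compositions_def)
  qed (auto simp: finite_compositions)
  also have "\<dots> = (\<Sum>m<n. A m N)"
    unfolding A_def by (intro sum.cong refl card_image) (auto simp: inj_on_def)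
  finally show ?thesis .
qed

text \<open>
  The exponent \<open>N - 1\<close> is what makes the Dirichlet series converge absolutely on the whole
  half-plane \<open>Re s > N\<close>.
\<close>

lemma A_le:
  assumes "2 \<le> N"
  shows "A n N \<le> n ^ (N - 1)"
  using assms
proof (induction N arbitrary: n rule: dec_induct)
  case base
  have "not_exceeding_compositions n 2 \<subseteq> (\<lambda>k. [k, n - k]) ` {1..n}"
    by (auto simp: not_exceeding_compositions_def length_Suc_conv numeral_2_eq_2 image_iff)
  then have "A n 2 \<le> card {1..n}"
    unfolding A_def by (rule surj_card_le [rotated]) simp
  then show ?case by simp
next
  case (step N)
  have "A n (Suc N) \<le> (\<Sum>m<n. n ^ (N - 1))"
    unfolding A_Suc [OF step.hyps(1)]
    by (intro sum_mono order.trans [OF step.IH] power_mono) auto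
  also have "\<dots> = n ^ N"
    using step.hyps by (simp flip: power_Suc)
  finally show ?case by simp
qed

section \<open>The Gamma function on vertical lines\<close>

text \<open>
  Substituting \<open>x = exp u\<close> in Euler's integral over \<open>x > 0\<close> turns a Mellin transform into a
  Fourier transform: with \<open>z = c + \<i> t\<close> the factor \<open>exp (\<i> t u)\<close> splits off. Scaling
  \<open>x\<close> by \<open>a\<close> becomes a translation of \<open>u\<close> by \<open>ln a\<close>.
\<close>

lemma has_bochner_integral_Gamma_exp:
  fixes z :: complex and a :: real
  assumes z: "Re z > 0" and a: "a > 0"
  shows "has_bochner_integral lborel (\<lambda>u. exp (z * of_real u - of_real (a * exp u)))
           (Gamma z * of_real a powr (- z))"
proof -
  define f where "f x = complex_of_real x powr (z - 1) / of_real (exp x)" for x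
  define h where "h u = exp (z * of_real u - of_real (exp u))" for u :: real
  have h_eq: "of_real (exp u) * f (exp u) = h u" for u
  proof -
    have "complex_of_real (exp u) powr (z - 1) = exp (of_real u * (z - 1))"
      by (simp add: powr_def exp_of_real [symmetric] Ln_of_real mult.commute)
    then have "of_real (exp u) * f (exp u)
        = exp (of_real u) * (exp (of_real u * (z - 1)) / exp (of_real (exp u)))"
      by (simp add: f_def exp_of_real)
    also have "\<dots> = h u"
      by (simp add: h_def exp_add [symmetric] exp_diff [symmetric] algebra_simps)
    finally show ?thesis .
  qed
  have f_abs: "f absolutely_integrable_on {0<..}"
    unfolding f_def by (rule absolutely_integrable_Gamma_integral') fact
  have f_int: "(f has_integral Gamma z) {0<..}"
    unfolding f_def by (rule Gamma_integral_complex') fact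
  \<comment> \<open>The substitution is made in real-valued integrals: \<open>T\<close> stands for \<open>Re\<close> and \<open>Im\<close>.\<close>
  have subst: "(\<lambda>u. T (h u)) absolutely_integrable_on UNIV \<and> integral UNIV (\<lambda>u. T (h u)) = T (Gamma z)"
    if T: "bounded_linear (T :: complex \<Rightarrow> real)" for T
  proof -
    have "(\<lambda>x. T (f x)) absolutely_integrable_on {0<..} \<and> integral {0<..} (\<lambda>x. T (f x)) = T (Gamma z)"
      using absolutely_integrable_linear [OF f_abs T] has_integral_linear [OF f_int T]
      by (auto simp: o_def integral_unique)
    moreover have "range exp = {0::real<..}"
      by (auto simp: image_iff) (metis exp_ln)
    moreover have "exp u * T (f (exp u)) = T (h u)" for u
      using linear_scale [OF bounded_linear.linear [OF T], of "exp u" "f (exp u)"] h_eq [of u]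
      by (simp add: scaleR_conv_of_real)
    ultimately show ?thesis
      using has_absolute_integral_change_of_variables_1'
        [of UNIV exp exp "\<lambda>x. T (f x)" "T (Gamma z)"]
      by (auto intro!: derivative_eq_intros simp: inj_on_def)
  qed
  have h_meas [measurable]: "h \<in> borel_measurable borel"
    unfolding h_def by measurable
  have *: "integrable lborel (\<lambda>u. T (h u)) \<and> integral\<^sup>L lborel (\<lambda>u. T (h u)) = T (Gamma z)"
    if T: "bounded_linear (T :: complex \<Rightarrow> real)" for T
  proof -
    have [measurable]: "(\<lambda>u. T (h u)) \<in> borel_measurable borel"
      by (intro borel_measurable_continuous_on [OF _ h_meas] linear_continuous_on T)
    have "set_integrable lebesgue UNIV (\<lambda>u. T (h u))" "(LINT u:UNIV|lebesgue. T (h u)) = T (Gamma z)"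
      using subst [OF T] set_lebesgue_integral_eq_integral(2) [of UNIV "\<lambda>u. T (h u)"] by auto
    then show ?thesis
      by (simp add: set_integrable_def set_lebesgue_integral_def integrable_completion integral_completion)
  qed
  have "has_bochner_integral lborel (\<lambda>u. of_real (Re (h u)) + \<i> * of_real (Im (h u)))
         (of_real (Re (Gamma z)) + \<i> * of_real (Im (Gamma z)))"
    using * [OF bounded_linear_Re] * [OF bounded_linear_Im]
    by (intro has_bochner_integral_add has_bochner_integral_mult_right has_bochner_integral_of_real)
       (auto simp: has_bochner_integral_iff)
  then have h_int: "has_bochner_integral lborel h (Gamma z)"
    by (simp add: complex_eq [symmetric])
  have "has_bochner_integral lborel (\<lambda>u. h (ln a + 1 * u)) (Gamma z)"
    using h_int lborel_integrable_real_affine [of h 1 "ln a"] lborel_integral_real_affine [of 1 h "ln a"]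
    by (simp add: has_bochner_integral_iff)
  then have "has_bochner_integral lborel (\<lambda>u. h (ln a + 1 * u) * of_real a powr (- z))
      (Gamma z * of_real a powr (- z))"
    by (rule has_bochner_integral_mult_left)
  moreover have "h (ln a + 1 * u) * of_real a powr (- z) = exp (z * of_real u - of_real (a * exp u))" for u
    using a by (simp add: h_def powr_def Ln_of_real exp_add [symmetric] exp_diff algebra_simps)
       (simp add: exp_add exp_minus exp_diff field_simps)
  ultimately show ?thesis by simp
qed

lemma norm_Gamma_le:
  fixes z :: complex
  assumes z: "Re z > 0"
  shows "norm (Gamma z) \<le> Gamma (Re z)"
proof -
  have 1: "has_bochner_integral lborel (\<lambda>u. exp (z * of_real u - of_real (exp u))) (Gamma z)"
    using has_bochner_integral_Gamma_exp [OF z, of 1] by simp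
  have "has_bochner_integral lborel (\<lambda>u. exp (complex_of_real (Re z) * of_real u - of_real (exp u))) (Gamma (of_real (Re z)))"
    using has_bochner_integral_Gamma_exp [of "of_real (Re z)" 1] z by simp
  then have "has_bochner_integral lborel (\<lambda>u. complex_of_real (exp (Re z * u - exp u))) (of_real (Gamma (Re z)))"
    by (simp add: Gamma_complex_of_real exp_of_real [symmetric])
  from has_bochner_integral_Re [OF this]
  have 2: "has_bochner_integral lborel (\<lambda>u. exp (Re z * u - exp u)) (Gamma (Re z))"
    by simp
  have "norm (Gamma z) \<le> integral\<^sup>L lborel (\<lambda>u. norm (exp (z * of_real u - of_real (exp u))))"
    using integral_norm_bound [of lborel "\<lambda>u. exp (z * of_real u - of_real (exp u))"] 1
    by (simp add: has_bochner_integral_iff)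
  also have "\<dots> = Gamma (Re z)"
    using 2 by (simp add: has_bochner_integral_iff)
  finally show ?thesis .
qed

lemma continuous_on_Gamma_vertical:
  assumes "c > 0"
  shows "continuous_on UNIV (\<lambda>t::real. Gamma (of_real c + \<i> * of_real t))"
proof (rule continuous_on_compose2 [of "- \<int>\<^sub>\<le>\<^sub>0" Gamma])
  show "range (\<lambda>t::real. of_real c + \<i> * of_real t) \<subseteq> - (\<int>\<^sub>\<le>\<^sub>0 :: complex set)"
    using assms by (auto elim!: nonpos_Ints_cases simp: complex_eq_iff)
qed (auto intro!: continuous_intros continuous_on_Gamma)

text \<open>
  In \<open>\<Gamma> z = \<Gamma> (z + 2) / (z * (z + 1))\<close> the numerator is bounded on the line by the value of
  \<open>\<Gamma>\<close> at \<open>c + 2\<close>, and the denominator grows quadratically.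
\<close>

lemma integrable_Gamma_vertical:
  assumes c: "c > 0"
  shows "integrable lborel (\<lambda>t::real. Gamma (of_real c + \<i> * of_real t))"
proof -
  define K where "K = Gamma (c + 2) / min 1 (c\<^sup>2)"
  have "integrable lborel (\<lambda>x::real. inverse (1 + x\<^sup>2))"
    using integrable_inverse_1_plus_square by (simp add: set_integrable_def)
  then have int: "integrable lborel (\<lambda>x::real. K * inverse (1 + x\<^sup>2))"
    by simp
  have bound: "norm (Gamma (of_real c + \<i> * of_real t)) \<le> K * inverse (1 + t\<^sup>2)" for t :: real
  proof -
    define z where "z = of_real c + \<i> * complex_of_real t"
    have z: "Re z = c" "Im z = t" by (simp_all add: z_def)
    have nz: "z \<notin> \<int>\<^sub>\<le>\<^sub>0" "z + 1 \<notin> \<int>\<^sub>\<le>\<^sub>0" "z \<noteq> 0" "z + 1 \<noteq> 0"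
      using c z by (auto elim!: nonpos_Ints_cases simp: complex_eq_iff)
    have "Gamma (z + 2) = (z + 1) * z * Gamma z"
      using Gamma_plus1 [of z] Gamma_plus1 [of "z + 1"] nz by (simp add: add.assoc)
    then have eq: "norm (Gamma (z + 2)) = norm (z + 1) * norm z * norm (Gamma z)"
      by (simp add: norm_mult)
    have le: "norm z \<le> norm (z + 1)"
      unfolding norm_complex_def using c z by (simp add: power2_eq_square algebra_simps)
    have "min 1 (c\<^sup>2) * (1 + t\<^sup>2) \<le> c\<^sup>2 + t\<^sup>2"
      by (auto simp: min_def algebra_simps intro: mult_right_le_one_le mult_left_le_one_le)
    also have "\<dots> = norm z * norm z"
      by (simp add: cmod_power2 z flip: power2_eq_square)
    also have "\<dots> \<le> norm (z + 1) * norm z"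
      using le by (intro mult_right_mono) auto
    finally have "min 1 (c\<^sup>2) * (1 + t\<^sup>2) * norm (Gamma z) \<le> norm (Gamma (z + 2))"
      unfolding eq by (intro mult_right_mono) auto
    also have "\<dots> \<le> Gamma (c + 2)"
      using norm_Gamma_le [of "z + 2"] z c by simp
    finally have "norm (Gamma z) \<le> K * inverse (1 + t\<^sup>2)"
      using c by (simp add: K_def field_simps add_pos_nonneg)
    then show ?thesis by (simp add: z_def)
  qed
  have "(\<lambda>t::real. Gamma (of_real c + \<i> * of_real t)) \<in> borel_measurable lborel"
    using continuous_on_Gamma_vertical [OF c] by (simp add: borel_measurable_continuous_onI)
  then show ?thesis
    by (rule Bochner_Integration.integrable_bound [OF int])
       (auto intro!: AE_I2 order.trans [OF bound])
qed

section \<open>Fourier inversion\<close>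

lemma Fourier_integral_Gaussian:
  fixes w :: real
  shows "has_bochner_integral lborel (\<lambda>t. iexp (t * w) * of_real (exp (- t\<^sup>2 / 2)))
           (of_real (sqrt (2 * pi) * exp (- w\<^sup>2 / 2)))"
proof -
  have "integrable lborel (\<lambda>t. std_normal_density t *\<^sub>R iexp (w * t))"
    by (rule Bochner_Integration.integrable_bound [OF integrable_std_normal_moment [of 0]]) auto
  moreover have "integral\<^sup>L lborel (\<lambda>t. std_normal_density t *\<^sub>R iexp (w * t)) = of_real (exp (- w\<^sup>2 / 2))"
    using char_std_normal_distribution
    by (subst integral_density [symmetric]) (auto simp: char_def fun_eq_iff)
  ultimately have "has_bochner_integral lborel
      (\<lambda>t. of_real (sqrt (2 * pi)) * (std_normal_density t *\<^sub>R iexp (w * t)))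
      (of_real (sqrt (2 * pi)) * of_real (exp (- w\<^sup>2 / 2)))"
    by (intro has_bochner_integral_mult_right) (simp add: has_bochner_integral_iff)
  then show ?thesis
    by (simp add: std_normal_density_def scaleR_conv_of_real mult_ac)
qed

text \<open>
  The integral of the inverse transform is regularised by the factor \<open>exp (- (e t)\<^sup>2 / 2)\<close>.
  Fubini and self-duality of the Gaussian then turn it into an average of \<open>g\<close> around \<open>u\<close>
  against a Gaussian of width \<open>e\<close>. As \<open>e\<close> tends to \<open>0\<close>, dominated convergence applies on
  both sides: on one because \<open>G\<close> is integrable, on the other because \<open>g\<close> is bounded and
  continuous.
\<close>

lemma Fourier_inversion:
  fixes g :: "real \<Rightarrow> complex" and u :: real
  assumes cont: "continuous_on UNIV g" and bdd: "\<And>v. norm (g v) \<le> B"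
    and int: "integrable lborel g"
  defines "G \<equiv> \<lambda>t::real. \<integral>v. iexp (t * v) * g v \<partial>lborel"
  assumes intG: "integrable lborel G"
  shows "(\<integral>t. iexp (- (t * u)) * G t \<partial>lborel) = 2 * of_real pi * g u"
proof -
  define E where "E x = exp (- x\<^sup>2 / 2)" for x :: real
  have E_le: "0 \<le> E x" "E x \<le> 1" for x by (auto simp: E_def)
  have E0: "E 0 = 1" by (simp add: E_def)
  have contE: "continuous_on UNIV E"
    unfolding E_def by (intro continuous_intros) auto
  note [measurable] = borel_measurable_continuous_onI [OF cont] borel_measurable_continuous_onI [OF contE]
  have [measurable]: "G \<in> borel_measurable borel" using intG by auto
  have E_int: "has_bochner_integral lborel (\<lambda>t. iexp (t * w) * of_real (E t)) (of_real (sqrt (2 * pi) * E w))" for w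
    unfolding E_def by (rule Fourier_integral_Gaussian)
  from E_int [of 0] have intE: "integrable lborel E"
    by (simp add: has_bochner_integral_iff complex_of_real_integrable_eq)
  have intE_total: "integral\<^sup>L lborel E = sqrt (2 * pi)"
    using E_int [of 0] of_real_eq_iff[where 'a=complex] unfolding E0 by (simp add: has_bochner_integral_iff flip: of_real_mult)
  have key: "(\<integral>t. iexp (- (t * u)) * G t * of_real (E (e * t)) \<partial>lborel)
      = of_real (sqrt (2 * pi)) * (\<integral>x. g (u + e * x) * of_real (E x) \<partial>lborel)" if e: "e > 0" for e
  proof -
    have intEe: "integrable lborel (\<lambda>t. E (e * t))"
      using lborel_integrable_real_affine [OF intE, of e 0] e by simp
    define F where "F t v = iexp (t * (v - u)) * of_real (E (e * t)) * g v" for t v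
    have F_int: "integrable (lborel \<Otimes>\<^sub>M lborel) (case_prod F)"
    proof (rule lborel_pair.Fubini_integrable)
      show "case_prod F \<in> borel_measurable (lborel \<Otimes>\<^sub>M lborel)"
        unfolding F_def by measurable
      have "(\<lambda>t. \<integral>v. norm (case_prod F (t, v)) \<partial>lborel) = (\<lambda>t. E (e * t) * (\<integral>v. norm (g v) \<partial>lborel))"
        using E_le by (simp add: F_def norm_mult abs_of_nonneg)
      then show "integrable lborel (\<lambda>t. \<integral>v. norm (case_prod F (t, v)) \<partial>lborel)"
        using intEe by simp
      have "integrable lborel (\<lambda>v. F t v)" for t
        unfolding F_def
        by (rule Bochner_Integration.integrable_bound [OF int])
           (use E_le in \<open>auto simp: norm_mult abs_of_nonneg intro!: AE_I2 mult_left_le_one_le \<close>)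
      then show "AE t in lborel. integrable lborel (\<lambda>v. case_prod F (t, v))"
        by simp
    qed
    have inner1: "(\<integral>v. F t v \<partial>lborel) = iexp (- (t * u)) * G t * of_real (E (e * t))" for t
    proof -
      have "F t v = iexp (- (t * u)) * of_real (E (e * t)) * (iexp (t * v) * g v)" for v
        by (simp add: F_def right_diff_distrib exp_diff exp_minus field_simps)
      then show ?thesis by (simp add: G_def)
    qed
    have inner2: "(\<integral>t. F t v \<partial>lborel) = of_real (sqrt (2 * pi) / e * E ((v - u) / e)) * g v" for v
    proof -
      have "(\<integral>t. iexp (t * ((v - u) / e)) * of_real (E t) \<partial>lborel)
          = e *\<^sub>R (\<integral>t. iexp (t * (v - u)) * of_real (E (e * t)) \<partial>lborel)"
        using lborel_integral_real_affine [of e "\<lambda>t. iexp (t * ((v - u) / e)) * of_real (E t)" 0] e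
        by (simp add: mult.commute mult.left_commute)
      moreover have "(\<integral>t. iexp (t * ((v - u) / e)) * of_real (E t) \<partial>lborel) = of_real (sqrt (2 * pi) * E ((v - u) / e))"
        using E_int has_bochner_integral_integral_eq by blast
      ultimately have "(\<integral>t. iexp (t * (v - u)) * of_real (E (e * t)) \<partial>lborel) = of_real (sqrt (2 * pi) / e * E ((v - u) / e))"
        using e by (simp add: scaleR_conv_of_real field_simps)
      then show ?thesis by (simp add: F_def)
    qed
    have "(\<integral>t. iexp (- (t * u)) * G t * of_real (E (e * t)) \<partial>lborel) = (\<integral>t. (\<integral>v. F t v \<partial>lborel) \<partial>lborel)"
      by (simp add: inner1)
    also have "\<dots> = (\<integral>v. (\<integral>t. F t v \<partial>lborel) \<partial>lborel)"
      using lborel_pair.Fubini_integral [OF F_int] by simp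
    also have "\<dots> = (\<integral>v. of_real (sqrt (2 * pi) / e * E ((v - u) / e)) * g v \<partial>lborel)"
      by (simp only: inner2)
    also have "\<dots> = e *\<^sub>R (\<integral>x. of_real (sqrt (2 * pi) / e * E x) * g (u + e * x) \<partial>lborel)"
      using lborel_integral_real_affine [of e "\<lambda>v. of_real (sqrt (2 * pi) / e * E ((v - u) / e)) * g v" u] e
      by simp
    also have "\<dots> = e *\<^sub>R (of_real (sqrt (2 * pi) / e) * (\<integral>x. g (u + e * x) * of_real (E x) \<partial>lborel))"
      by (subst integral_mult_right_zero [symmetric]) (simp add: mult_ac)
    also have "\<dots> = of_real (sqrt (2 * pi)) * (\<integral>x. g (u + e * x) * of_real (E x) \<partial>lborel)"
      using e by (simp add: scaleR_conv_of_real)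
    finally show ?thesis .
  qed
  define e where "e n = inverse (real (Suc n))" for n
  have e0: "e \<longlonglongrightarrow> 0" unfolding e_def by (rule LIMSEQ_inverse_real_of_nat)
  have epos: "e n > 0" for n by (simp add: e_def)
  have E_lim: "(\<lambda>n. E (e n * t)) \<longlonglongrightarrow> 1" for t
  proof -
    have "(\<lambda>n. E (e n * t)) \<longlonglongrightarrow> E (0 * t)"
      using tendsto_mult [OF e0 tendsto_const [of t]]
      by (intro continuous_on_tendsto_compose [OF contE]) auto
    then show ?thesis by (simp add: E0)
  qed
  have lim1: "(\<lambda>n. \<integral>t. iexp (- (t * u)) * G t * of_real (E (e n * t)) \<partial>lborel)
      \<longlonglongrightarrow> (\<integral>t. iexp (- (t * u)) * G t \<partial>lborel)"
  proof (rule integral_dominated_convergence [where w = "\<lambda>t. norm (G t)"])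
    show "AE t in lborel. (\<lambda>n. iexp (- (t * u)) * G t * of_real (E (e n * t))) \<longlonglongrightarrow> iexp (- (t * u)) * G t"
      using tendsto_mult [OF tendsto_const tendsto_of_real [OF E_lim]] by (intro AE_I2) fastforce
    show "AE t in lborel. norm (iexp (- (t * u)) * G t * of_real (E (e n * t))) \<le> norm (G t)" for n
      using E_le by (intro AE_I2) (auto simp: norm_mult abs_of_nonneg intro!: mult_right_le_one_le)
  qed (use intG in auto)
  have lim2: "(\<lambda>n. \<integral>x. g (u + e n * x) * of_real (E x) \<partial>lborel) \<longlonglongrightarrow> (\<integral>x. g u * of_real (E x) \<partial>lborel)"
  proof (rule integral_dominated_convergence [where w = "\<lambda>x. B * E x"])
    show "AE x in lborel. (\<lambda>n. g (u + e n * x) * of_real (E x)) \<longlonglongrightarrow> g u * of_real (E x)"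
    proof (intro AE_I2 tendsto_mult tendsto_const)
      fix x
      have "(\<lambda>n. u + e n * x) \<longlonglongrightarrow> u + 0 * x" by (intro tendsto_intros e0)
      from continuous_on_tendsto_compose [OF cont this]
      show "(\<lambda>n. g (u + e n * x)) \<longlonglongrightarrow> g u" by simp
    qed
    show "AE x in lborel. norm (g (u + e n * x) * of_real (E x)) \<le> B * E x" for n
      using E_le bdd by (intro AE_I2) (auto simp: norm_mult abs_of_nonneg intro!: mult_right_mono)
  qed (use intE in auto)
  have "(\<integral>t. iexp (- (t * u)) * G t \<partial>lborel) = of_real (sqrt (2 * pi)) * (\<integral>x. g u * of_real (E x) \<partial>lborel)"
    using LIMSEQ_unique [OF lim1] tendsto_mult [OF tendsto_const lim2] key [OF epos] by simp
  also have "(\<integral>x. g u * of_real (E x) \<partial>lborel) = g u * of_real (sqrt (2 * pi))"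
    by (simp add: intE_total)
  also have "of_real (sqrt (2 * pi)) * (g u * of_real (sqrt (2 * pi)))
      = of_real (sqrt (2 * pi) * sqrt (2 * pi)) * g u"
    by (simp only: of_real_mult mult_ac)
  also have "sqrt (2 * pi) * sqrt (2 * pi) = 2 * pi"
    by simp
  also have "of_real (2 * pi) * g u = 2 * of_real pi * g u"
    by simp
  finally show ?thesis .
qed

section \<open>The Mellin--Barnes integral for a power of a sum\<close>

text \<open>
  The inverse Mellin transform of \<open>\<Gamma>\<close> is the exponential function. In the variable
  \<open>u\<close> it is Fourier inversion for \<open>exp (c v - b exp v)\<close>, whose transform is
  \<open>\<Gamma> (c + \<i> t) b\<^bsup>- (c + \<i> t)\<^esup>\<close>.
\<close>

lemma Cahen_Mellin:
  fixes b c u :: real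
  assumes b: "b > 0" and c: "c > 0"
  shows "(\<integral>t. Gamma (of_real c + \<i> * of_real t) * of_real b powr (- (of_real c + \<i> * of_real t))
            * exp (- ((of_real c + \<i> * of_real t) * of_real u)) \<partial>lborel)
         = 2 * of_real pi * of_real (exp (- b * exp u))"
proof -
  define g where "g v = exp (of_real c * of_real v - complex_of_real (b * exp v))" for v :: real
  define H where "H t = Gamma (of_real c + \<i> * of_real t) * of_real b powr (- (of_real c + \<i> * of_real t))" for t :: real
  have H_eq: "H = (\<lambda>t. \<integral>v. iexp (t * v) * g v \<partial>lborel)"
  proof
    fix t
    have "has_bochner_integral lborel
       (\<lambda>v. exp ((of_real c + \<i> * of_real t) * of_real v - of_real (b * exp v))) (H t)"
      unfolding H_def using b c by (intro has_bochner_integral_Gamma_exp) auto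
    moreover have "exp ((of_real c + \<i> * of_real t) * of_real v - of_real (b * exp v)) = iexp (t * v) * g v" for v
      by (simp add: g_def exp_add [symmetric] algebra_simps)
    ultimately show "H t = (\<integral>v. iexp (t * v) * g v \<partial>lborel)"
      by (simp add: has_bochner_integral_iff)
  qed
  have int: "integrable lborel g"
    using has_bochner_integral_Gamma_exp [of "of_real c" b] b c
    by (simp add: g_def [abs_def] has_bochner_integral_iff)
  have norm_b: "norm (of_real b powr (- (of_real c + \<i> * of_real t))) = b powr (- c)" for t :: real
    using b by (simp add: norm_powr_real_powr)
  have intH: "integrable lborel H"
  proof (rule Bochner_Integration.integrable_bound)
    show "integrable lborel (\<lambda>t. b powr (- c) * norm (Gamma (of_real c + \<i> * of_real t)))"
      using integrable_Gamma_vertical [OF c] by simp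
    show "H \<in> borel_measurable lborel"
      using b unfolding H_def powr_def
      by (auto intro!: borel_measurable_continuous_onI continuous_intros continuous_on_Gamma_vertical c)
    show "AE t in lborel. norm (H t) \<le> norm (b powr (- c) * norm (Gamma (of_real c + \<i> * of_real t)))"
      by (intro AE_I2) (simp only: H_def norm_mult norm_b, simp)
  qed
  \<comment> \<open>The exponent \<open>c v - b exp v\<close> is maximal at \<open>v = ln (c / b)\<close>,
    with value \<open>c ln (c / b) - c\<close>.\<close>
  obtain B where B: "norm (g v) \<le> B" for v
  proof
    fix v :: real
    have "c * v - b * exp v \<le> c * (ln (c / b))"
    proof -
      have "1 + (v - ln (c / b)) \<le> exp (v - ln (c / b))" by (rule exp_ge_add_one_self)
      also have "\<dots> = exp v * b / c" using b c by (simp add: exp_diff)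
      finally have "c * (1 + (v - ln (c / b))) \<le> b * exp v" using c by (simp add: field_simps)
      then show ?thesis using c by (simp add: algebra_simps)
    qed
    then show "norm (g v) \<le> exp (c * (ln (c / b)))"
      by (simp add: g_def)
  qed
  have inv: "(\<integral>t. iexp (- (t * u)) * H t \<partial>lborel) = 2 * of_real pi * g u"
    using Fourier_inversion [of g B u] int B intH unfolding H_eq
    by (simp add: g_def continuous_intros)
  have "(\<integral>t. H t * exp (- ((of_real c + \<i> * of_real t) * of_real u)) \<partial>lborel)
      = (\<integral>t. exp (- (of_real c * of_real u)) * (iexp (- (t * u)) * H t) \<partial>lborel)"
    by (intro Bochner_Integration.integral_cong refl)
       (simp add: exp_add [symmetric] algebra_simps)
  also have "\<dots> = exp (- (of_real c * of_real u)) * (2 * of_real pi * g u)"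
    using inv by simp
  also have "\<dots> = 2 * of_real pi * (exp (- (of_real c * of_real u)) * g u)"
    by (simp add: mult_ac)
  also have "exp (- (of_real c * of_real u)) * g u = of_real (exp (- b * exp u))"
    by (simp add: g_def exp_add [symmetric] exp_of_real [symmetric])
  finally show ?thesis
    by (simp only: H_def)
qed

text \<open>
  The bound separates \<open>t\<close> from \<open>a\<close> and \<open>b\<close>. This is what later allows a double series over
  \<open>a\<close> and \<open>b\<close> to be integrated term by term.
\<close>

lemma
  fixes a b c :: real and s :: complex
  assumes a: "a > 0" and b: "b > 0" and c: "0 < c" "c < Re s"
  defines "\<tau> \<equiv> \<lambda>t::real. of_real c + \<i> * of_real t"
  defines "f \<equiv> \<lambda>t. Gamma (s - \<tau> t) * of_real a powr (- (s - \<tau> t)) * Gamma (\<tau> t) * of_real b powr (- \<tau> t)"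
  shows integrable_Mellin_Barnes: "integrable lborel f"
    and norm_Mellin_Barnes_le: "norm (f t) \<le> Gamma (Re s - c) * norm (Gamma (\<tau> t)) * (a powr (- (Re s - c)) * b powr (- c))"
proof -
  show bound: "norm (f t) \<le> Gamma (Re s - c) * norm (Gamma (\<tau> t)) * (a powr (- (Re s - c)) * b powr (- c))" for t
  proof -
    have "norm (Gamma (s - \<tau> t)) \<le> Gamma (Re s - c)"
      using norm_Gamma_le [of "s - \<tau> t"] c by (simp add: \<tau>_def)
    moreover have "norm (of_real a powr (- (s - \<tau> t))) = a powr (- (Re s - c))"
      "norm (of_real b powr (- \<tau> t)) = b powr (- c)"
      using a b by (simp_all add: norm_powr_real_powr \<tau>_def)
    ultimately have "norm (f t) \<le> Gamma (Re s - c) * a powr (- (Re s - c)) * norm (Gamma (\<tau> t)) * b powr (- c)"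
      unfolding f_def norm_mult using c by (intro mult_right_mono mult_mono mult_nonneg_nonneg) auto
    then show ?thesis by (simp add: mult_ac)
  qed
  have cont: "continuous_on UNIV (\<lambda>t. Gamma (s - \<tau> t))"
  proof (rule continuous_on_compose2 [of "- \<int>\<^sub>\<le>\<^sub>0" Gamma])
    show "range (\<lambda>t::real. s - \<tau> t) \<subseteq> - (\<int>\<^sub>\<le>\<^sub>0 :: complex set)"
      using c by (auto elim!: nonpos_Ints_cases simp: complex_eq_iff \<tau>_def)
  qed (auto intro!: continuous_intros continuous_on_Gamma simp: \<tau>_def)
  have cont_\<tau>: "continuous_on UNIV \<tau>"
    unfolding \<tau>_def by (intro continuous_intros)
  have cont_\<Gamma>: "continuous_on UNIV (\<lambda>t. Gamma (\<tau> t))"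
    unfolding \<tau>_def by (rule continuous_on_Gamma_vertical [OF c(1)])
  have "continuous_on UNIV f"
    using a b unfolding f_def powr_def
    by (auto intro!: continuous_on_mult cont cont_\<Gamma> continuous_on_exp continuous_on_diff
          continuous_on_minus cont_\<tau>)
  then have meas: "f \<in> borel_measurable lborel"
    by (simp add: borel_measurable_continuous_onI)
  show "integrable lborel f"
    by (rule Bochner_Integration.integrable_bound [OF _ meas, of
          "\<lambda>t. Gamma (Re s - c) * norm (Gamma (\<tau> t)) * (a powr (- (Re s - c)) * b powr (- c))"])
       (use integrable_Gamma_vertical [OF c(1)] bound in \<open>auto simp: \<tau>_def intro: order.trans [OF _ abs_ge_self]\<close>)
qed

text \<open>
  Write \<open>\<Gamma> (s - \<tau>) a\<^bsup>- (s - \<tau>)\<^esup>\<close> as an integral over \<open>u\<close> and exchange it with the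
  integral over \<open>\<tau>\<close>. The inner integral is then an inverse Mellin transform equal to
  \<open>exp (- b exp u)\<close>, which merges with \<open>exp (- a exp u)\<close>, and the outer one is the integral
  of \<open>\<Gamma> (s)\<close> with parameter \<open>a + b\<close>.
\<close>

lemma Mellin_Barnes_integral:
  fixes a b c :: real and s :: complex
  assumes a: "a > 0" and b: "b > 0" and c: "0 < c" "c < Re s"
  defines "\<tau> \<equiv> \<lambda>t::real. of_real c + \<i> * of_real t"
  shows "(\<integral>t. Gamma (s - \<tau> t) * of_real a powr (- (s - \<tau> t)) * Gamma (\<tau> t) * of_real b powr (- \<tau> t) \<partial>lborel)
           = 2 * of_real pi * Gamma s * of_real (a + b) powr (- s)"
proof -
  define H where "H t = Gamma (\<tau> t) * of_real b powr (- \<tau> t)" for t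
  define F where "F t u = H t * exp ((s - \<tau> t) * of_real u - of_real (a * exp u))" for t u
  have contH: "continuous_on UNIV H"
    using b unfolding H_def powr_def \<tau>_def
    by (auto intro!: continuous_intros continuous_on_Gamma_vertical c)
  have [measurable]: "H \<in> borel_measurable borel"
    by (rule borel_measurable_continuous_onI [OF contH])
  have [measurable]: "\<tau> \<in> borel_measurable borel"
    unfolding \<tau>_def by (intro borel_measurable_continuous_onI continuous_intros)
  have norm_H: "norm (H t) = norm (Gamma (\<tau> t)) * b powr (- c)" for t
    using b by (simp add: H_def norm_mult norm_powr_real_powr \<tau>_def)
  have intH: "integrable lborel (\<lambda>t. norm (H t))"
    unfolding norm_H using integrable_Gamma_vertical [OF c(1)] by (simp add: \<tau>_def)
  have G: "has_bochner_integral lborel (\<lambda>u. exp ((s - \<tau> t) * of_real u - of_real (a * exp u)))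
        (Gamma (s - \<tau> t) * of_real a powr (- (s - \<tau> t)))" for t
    using c a by (intro has_bochner_integral_Gamma_exp) (auto simp: \<tau>_def)
  have norm_F: "norm (F t u) = norm (H t) * exp ((Re s - c) * u - a * exp u)" for t u
    by (simp add: F_def norm_mult \<tau>_def)
  have F_int: "integrable (lborel \<Otimes>\<^sub>M lborel) (case_prod F)"
  proof (rule lborel_pair.Fubini_integrable)
    show "case_prod F \<in> borel_measurable (lborel \<Otimes>\<^sub>M lborel)"
      unfolding F_def by measurable
    show "integrable lborel (\<lambda>t. \<integral>u. norm (case_prod F (t, u)) \<partial>lborel)"
      using intH by (simp add: norm_F)
    have "integrable lborel (\<lambda>u. F t u)" for t
      using G [of t] by (simp add: F_def has_bochner_integral_iff)
    then show "AE t in lborel. integrable lborel (\<lambda>u. case_prod F (t, u))" by simp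
  qed
  have inner1: "(\<integral>u. F t u \<partial>lborel)
      = Gamma (s - \<tau> t) * of_real a powr (- (s - \<tau> t)) * Gamma (\<tau> t) * of_real b powr (- \<tau> t)" for t
    using G [of t] by (simp add: F_def H_def has_bochner_integral_iff mult_ac)
  have inner2: "(\<integral>t. F t u \<partial>lborel) = 2 * of_real pi * exp (s * of_real u - of_real ((a + b) * exp u))" for u
  proof -
    have "F t u = exp (s * of_real u - of_real (a * exp u)) * (H t * exp (- (\<tau> t * of_real u)))" for t
      by (simp add: F_def exp_add [symmetric] algebra_simps exp_diff exp_minus field_simps)
    then have "(\<integral>t. F t u \<partial>lborel) = exp (s * of_real u - of_real (a * exp u)) * (2 * of_real pi * of_real (exp (- b * exp u)))"
      using Cahen_Mellin [OF b c(1), of u] by (simp add: H_def \<tau>_def mult.assoc)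
    also have "\<dots> = 2 * of_real pi * (exp (s * of_real u - of_real (a * exp u)) * exp (- of_real (b * exp u)))"
      by (simp add: exp_of_real [symmetric])
    also have "\<dots> = 2 * of_real pi * exp (s * of_real u - of_real ((a + b) * exp u))"
      by (simp add: exp_add [symmetric] algebra_simps)
    finally show ?thesis .
  qed
  have "(\<integral>t. (\<integral>u. F t u \<partial>lborel) \<partial>lborel) = (\<integral>u. (\<integral>t. F t u \<partial>lborel) \<partial>lborel)"
    using lborel_pair.Fubini_integral [OF F_int] by simp
  also have "\<dots> = 2 * of_real pi * (Gamma s * of_real (a + b) powr (- s))"
    using has_bochner_integral_Gamma_exp [of s "a + b"] a b c
    unfolding inner2 by (simp add: has_bochner_integral_iff)
  finally show ?thesis by (simp add: inner1 mult_ac)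
qed

section \<open>Termwise integration of unordered series\<close>

lemma infsum_eq_suminf_enumeration:
  fixes f :: "'i \<Rightarrow> 'b::banach"
  assumes h: "bij_betw h (UNIV :: nat set) I" and f: "f summable_on I"
  shows "summable (\<lambda>j. f (h j))" and "infsum f I = (\<Sum>j. f (h j))"
proof -
  have "(\<lambda>j. f (h j)) summable_on UNIV"
    using f summable_on_reindex_bij_betw [OF h] by blast
  then have "(\<lambda>j. f (h j)) sums infsum (\<lambda>j. f (h j)) UNIV"
    by (intro has_sum_imp_sums has_sum_infsum)
  then show "summable (\<lambda>j. f (h j))" and "infsum f I = (\<Sum>j. f (h j))"
    using infsum_reindex_bij_betw [OF h, of f] by (auto simp: sums_iff)
qed

text \<open>
  Termwise integration of an unordered series with a majorant of product form
  \<open>w x * a i\<close>. An enumeration of the index set reduces it to ordinary series.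
\<close>

lemma has_bochner_integral_infsum:
  fixes f :: "'i \<Rightarrow> 'a \<Rightarrow> 'b::{banach, second_countable_topology}"
  assumes I: "countable I" "infinite I"
    and f: "\<And>i. i \<in> I \<Longrightarrow> integrable M (f i)"
    and bound: "\<And>i x. i \<in> I \<Longrightarrow> norm (f i x) \<le> w x * a i"
    and w: "integrable M w" and a: "a summable_on I"
  shows "has_bochner_integral M (\<lambda>x. \<Sum>\<^sub>\<infinity>i\<in>I. f i x) (\<Sum>\<^sub>\<infinity>i\<in>I. integral\<^sup>L M (f i))"
proof -
  define h where "h = from_nat_into I"
  have h: "bij_betw h UNIV I"
    unfolding h_def using I by (rule bij_betw_from_nat_into)
  then have hI: "h j \<in> I" for j by (auto simp: bij_betw_def)
  have f_summable: "(\<lambda>i. norm (f i x)) summable_on I" for x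
    using summable_on_cmult_right [OF a] bound
    by (rule Infinite_Sum.abs_summable_on_comparison_test')
  have a_summable: "summable (\<lambda>j. a (h j))"
    by (rule infsum_eq_suminf_enumeration [OF h a])
  have int_le: "(\<integral>x. norm (f i x) \<partial>M) \<le> integral\<^sup>L M w * a i" if "i \<in> I" for i
  proof -
    have "(\<integral>x. norm (f i x) \<partial>M) \<le> (\<integral>x. w x * a i \<partial>M)"
      using that by (intro integral_mono integrable_norm f w bound integrable_mult_left)
    then show ?thesis by simp
  qed
  have int_summable: "(\<lambda>i. norm (integral\<^sup>L M (f i))) summable_on I"
    using summable_on_cmult_right [OF a] order.trans [OF integral_norm_bound int_le]
    by (rule Infinite_Sum.abs_summable_on_comparison_test')
  have sum_eq: "(\<Sum>\<^sub>\<infinity>i\<in>I. f i x) = (\<Sum>j. f (h j) x)" for x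
    by (rule infsum_eq_suminf_enumeration(2) [OF h abs_summable_summable [OF f_summable]])
  have norm_summable: "AE x in M. summable (\<lambda>j. norm (f (h j) x))"
    by (intro AE_I2 infsum_eq_suminf_enumeration(1) [OF h f_summable])
  have norm_int_summable: "summable (\<lambda>j. \<integral>x. norm (f (h j) x) \<partial>M)"
    by (rule summable_comparison_test' [where g = "\<lambda>j. integral\<^sup>L M w * a (h j)" and N = 0])
       (use a_summable int_le hI in \<open>auto simp: summable_mult\<close>)
  have "integrable M (\<lambda>x. \<Sum>j. f (h j) x)"
    "(\<integral>x. (\<Sum>j. f (h j) x) \<partial>M) = (\<Sum>j. integral\<^sup>L M (f (h j)))"
    using f [OF hI] norm_summable norm_int_summable
    by (rule integrable_suminf, rule integral_suminf)
  moreover have "(\<Sum>\<^sub>\<infinity>i\<in>I. integral\<^sup>L M (f i)) = (\<Sum>j. integral\<^sup>L M (f (h j)))"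
    by (rule infsum_eq_suminf_enumeration(2) [OF h abs_summable_summable [OF int_summable]])
  ultimately show ?thesis
    by (simp add: has_bochner_integral_iff sum_eq)
qed

section \<open>The Dirichlet series\<close>

lemma summable_on_Times_mult:
  fixes f :: "'a \<Rightarrow> real" and g :: "'b \<Rightarrow> real"
  assumes f: "f summable_on X" and g: "g summable_on Y"
    and "\<And>x. x \<in> X \<Longrightarrow> 0 \<le> f x" "\<And>y. y \<in> Y \<Longrightarrow> 0 \<le> g y"
  shows "(\<lambda>(x, y). f x * g y) summable_on X \<times> Y"
proof (rule summable_on_SigmaI)
  show "((\<lambda>y. case (x, y) of (x, y) \<Rightarrow> f x * g y) has_sum f x * infsum g Y) Y" for x
    using has_sum_cmult_right [OF has_sum_infsum [OF g]] by simp
  show "(\<lambda>x. f x * infsum g Y) summable_on X"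
    using f by (rule summable_on_cmult_left)
qed (use assms in auto)

lemma summable_on_A_powr:
  fixes \<sigma> :: real
  assumes N: "2 \<le> N" and \<sigma>: "real N < \<sigma>"
  shows "(\<lambda>n. real (A n N) * real n powr (- \<sigma>)) summable_on X"
proof (rule summable_on_subset [OF _ subset_UNIV])
  have "(\<lambda>n. real n powr (real N - 1 - \<sigma>)) summable_on UNIV"
    using \<sigma> by (intro summable_nonneg_imp_summable_on) (auto simp: summable_real_powr_iff)
  then show "(\<lambda>n. real (A n N) * real n powr (- \<sigma>)) summable_on UNIV"
  proof (rule summable_on_comparison_test)
    fix n :: nat
    show "real (A n N) * real n powr (- \<sigma>) \<le> real n powr (real N - 1 - \<sigma>)"
    proof (cases "n = 0")
      case False
      have "real (A n N) \<le> real n powr (real N - 1)"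
      proof -
        have "real (A n N) \<le> real (n ^ (N - 1))"
          using A_le [OF N] of_nat_le_iff by blast
        also have "\<dots> = real n powr (real N - 1)"
          using N False by (simp add: powr_realpow [symmetric] of_nat_diff)
        finally show ?thesis .
      qed
      then have "real (A n N) * real n powr (- \<sigma>) \<le> real n powr (real N - 1) * real n powr (- \<sigma>)"
        by (rule mult_right_mono) simp
      then show ?thesis by (simp add: powr_add [symmetric])
    qed simp
  qed simp
qed

text \<open>
  The hypothesis \<open>\<sigma> - c > N\<close> gives convergence in \<open>m\<close>, and \<open>c > 1\<close> gives
  convergence in \<open>k\<close>. With \<open>\<sigma> = Re s\<close> these are the moduli of the terms of the double series
  for \<open>D N (s - \<tau>) \<zeta> (\<tau>)\<close> at every \<open>\<tau>\<close> on the line \<open>Re \<tau> = c\<close>. They also dominate the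
  terms of the double series for \<open>D (N + 1) s\<close>, as \<open>m + k\<close> is at least \<open>m\<close> and at least \<open>k\<close>.
\<close>

lemma summable_on_majorant:
  fixes c \<sigma> :: real
  assumes N: "2 \<le> N" and c: "1 < c" and \<sigma>: "real N + c < \<sigma>"
  shows "(\<lambda>(m, k). real (A m N) * (real m powr (- (\<sigma> - c)) * real k powr (- c)))
           summable_on {N..} \<times> {1..}"
proof -
  have 1: "(\<lambda>m. real (A m N) * real m powr (- (\<sigma> - c))) summable_on {N..}"
    using \<sigma> by (intro summable_on_A_powr N) simp
  have "(\<lambda>k. real k powr (- c)) summable_on UNIV"
    using c by (intro summable_nonneg_imp_summable_on) (auto simp: summable_real_powr_iff)
  then have 2: "(\<lambda>k. real k powr (- c)) summable_on {1..}"
    by (rule summable_on_subset) simp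
  show ?thesis
    using summable_on_Times_mult [OF 1 2] by (simp add: mult.assoc)
qed

text \<open>
  Collecting the pairs \<open>(m, k)\<close> by \<open>n = m + k\<close> reproduces the recursion for the number of
  compositions with a last part \<open>k\<close>.
\<close>

lemma D_Suc_eq_double_sum:
  fixes c :: real
  assumes N: "2 \<le> N" and c: "1 < c" and s: "real N + c < Re s"
  shows "D (N + 1) s = (\<Sum>\<^sub>\<infinity>(m, k)\<in>{N..} \<times> {1..}. of_nat (A m N) * of_nat (m + k) powr (- s))"
proof -
  define F where "F = (\<lambda>(m, k). complex_of_nat (A m N) * of_nat (m + k) powr (- s))"
  define F' where "F' = (\<lambda>(n, m). complex_of_nat (A m N) * of_nat n powr (- s))"
  have F_summable: "F summable_on {N..} \<times> {1..}"
  proof (rule abs_summable_summable, rule Infinite_Sum.abs_summable_on_comparison_test' [OF summable_on_majorant [OF N c s]])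
    fix p assume "p \<in> {N..} \<times> {1::nat..}"
    then obtain m k where p: "p = (m, k)" "N \<le> m" "1 \<le> k" by auto
    have pos: "real m > 0" "real k > 0" using p N by auto
    have "norm (of_nat (m + k) powr (- s)) = real (m + k) powr (- Re s)"
      using norm_powr_real_powr [of "of_nat (m + k)" "- s"] by simp
    also have "\<dots> = real (m + k) powr (- (Re s - c)) * real (m + k) powr (- c)"
      by (simp add: powr_add [symmetric])
    also have "\<dots> \<le> real m powr (- (Re s - c)) * real k powr (- c)"
      using pos c s by (intro mult_mono powr_mono2') auto
    finally show "norm (F p) \<le> (case p of (m, k) \<Rightarrow> real (A m N) * (real m powr (- (Re s - c)) * real k powr (- c)))"
      by (simp add: F_def p norm_mult mult_left_mono)
  qed
  have reindex_summable: "(F summable_on {N..} \<times> {1..}) = (F' summable_on (SIGMA n:{N + 1..}. {N..<n}))"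
    by (rule summable_on_reindex_bij_witness [where j = "\<lambda>(m, k). (m + k, m)" and i = "\<lambda>(n, m). (m, n - m)"])
       (auto simp: F_def F'_def)
  have reindex: "infsum F ({N..} \<times> {1..}) = infsum F' (SIGMA n:{N + 1..}. {N..<n})"
    by (rule infsum_reindex_bij_witness [where j = "\<lambda>(m, k). (m + k, m)" and i = "\<lambda>(n, m). (m, n - m)"])
       (auto simp: F_def F'_def)
  have inner: "(\<Sum>\<^sub>\<infinity>m\<in>{N..<n}. F' (n, m)) = of_nat (A n (N + 1)) * of_nat n powr (- s)" for n
  proof -
    have "(\<Sum>m<n. A m N) = (\<Sum>m\<in>{N..<n}. A m N)"
      by (rule sum.mono_neutral_right) (auto simp: A_eq_0)
    then have "A n (N + 1) = (\<Sum>m\<in>{N..<n}. A m N)"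
      using A_Suc [OF N, of n] by simp
    then show ?thesis
      by (simp add: F'_def sum_distrib_right)
  qed
  have "D (N + 1) s = (\<Sum>\<^sub>\<infinity>n\<in>{N + 1..}. \<Sum>\<^sub>\<infinity>m\<in>{N..<n}. F' (n, m))"
    unfolding D_def inner ..
  also have "\<dots> = infsum F' (SIGMA n:{N + 1..}. {N..<n})"
    using F_summable unfolding reindex_summable by (rule infsum_Sigma_banach)
  finally show ?thesis
    by (simp only: reindex [symmetric] F_def)
qed

section \<open>The integral recursion\<close>

theorem theorem4p18:
  fixes N :: nat and c :: real and s :: complex
  assumes "2 \<le> N" and "1 < c" and "real N + c < Re s"
  shows "vline_integrable c (\<lambda>\<tau>. D N (s - \<tau>) * Gamma (s - \<tau>) * Gamma \<tau> * zeta \<tau>) \<and>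
    D (N + 1) s =
      1 / (2 * of_real pi * \<i>) * (1 / Gamma s) *
        vline_integral c (\<lambda>\<tau>. D N (s - \<tau>) * Gamma (s - \<tau>) * Gamma \<tau> * zeta \<tau>)"
proof -
  define \<tau> where "\<tau> = (\<lambda>t::real. of_real c + \<i> * of_real t)"
  define I where "I = {N..} \<times> {1::nat..}"
  define a where "a = (\<lambda>(m, k). real (A m N) * (real m powr (- (Re s - c)) * real k powr (- c)))"
  define B where "B m k t = Gamma (s - \<tau> t) * of_real (real m) powr (- (s - \<tau> t)) * Gamma (\<tau> t)
                              * of_real (real k) powr (- \<tau> t)" for m k t
  define f where "f = (\<lambda>(m, k) t. of_nat (A m N) * B m k t)"
  define w where "w t = Gamma (Re s - c) * norm (Gamma (\<tau> t))" for t
  have c: "0 < c" "c < Re s" using assms by auto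
  have a_summable: "a summable_on I"
    unfolding a_def I_def by (rule summable_on_majorant [OF assms])
  have w_int: "integrable lborel w"
    unfolding w_def \<tau>_def using integrable_Gamma_vertical [OF c(1)] by simp
  have pos: "real m > 0" "real k > 0" if "(m, k) \<in> I" for m k
    using that assms by (auto simp: I_def)
  have f_int: "integrable lborel (f i)" if "i \<in> I" for i
    using that integrable_Mellin_Barnes [OF pos c]
    by (auto simp: f_def B_def \<tau>_def split: prod.splits)
  have f_bound: "norm (f i t) \<le> w t * a i" if "i \<in> I" for i t
  proof -
    obtain m k where i: "i = (m, k)" by (cases i)
    have "norm (B m k t) \<le> w t * (real m powr (- (Re s - c)) * real k powr (- c))"
      using norm_Mellin_Barnes_le [OF pos c, of m k m k, where t = t] that unfolding i B_def w_def \<tau>_def by blast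
    then have "real (A m N) * norm (B m k t)
        \<le> real (A m N) * (w t * (real m powr (- (Re s - c)) * real k powr (- c)))"
      by (rule mult_left_mono) simp
    then show ?thesis by (simp add: i f_def a_def norm_mult mult_ac)
  qed
  have I: "countable I" "infinite I"
    by (auto simp: I_def finite_cartesian_product_iff infinite_Ici)
  have main: "has_bochner_integral lborel (\<lambda>t. \<Sum>\<^sub>\<infinity>i\<in>I. f i t) (\<Sum>\<^sub>\<infinity>i\<in>I. integral\<^sup>L lborel (f i))"
    by (rule has_bochner_integral_infsum [OF I f_int f_bound w_int a_summable])
  have integrand: "(\<Sum>\<^sub>\<infinity>i\<in>I. f i t)
      = D N (s - \<tau> t) * Gamma (s - \<tau> t) * Gamma (\<tau> t) * zeta (\<tau> t)" for t
  proof -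
    have "(\<lambda>i. f i t) summable_on I"
      by (rule abs_summable_summable, rule Infinite_Sum.abs_summable_on_comparison_test')
         (rule summable_on_cmult_right [OF a_summable], rule f_bound)
    then have "(\<Sum>\<^sub>\<infinity>i\<in>I. f i t) = (\<Sum>\<^sub>\<infinity>m\<in>{N..}. \<Sum>\<^sub>\<infinity>k\<in>{1..}. f (m, k) t)"
      unfolding I_def by (rule infsum_Sigma_banach [symmetric])
    also have "\<dots> = (\<Sum>\<^sub>\<infinity>m\<in>{N..}. (of_nat (A m N) * of_nat m powr (- (s - \<tau> t)))
                       * (Gamma (s - \<tau> t) * Gamma (\<tau> t) * zeta (\<tau> t)))"
    proof (intro infsum_cong)
      fix m
      have "f (m, k) t = of_nat (A m N) * of_nat m powr (- (s - \<tau> t)) * (Gamma (s - \<tau> t) * Gamma (\<tau> t))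
              * of_nat k powr (- \<tau> t)" for k
        by (simp add: f_def B_def mult_ac)
      then show "(\<Sum>\<^sub>\<infinity>k\<in>{1..}. f (m, k) t) = (of_nat (A m N) * of_nat m powr (- (s - \<tau> t)))
                       * (Gamma (s - \<tau> t) * Gamma (\<tau> t) * zeta (\<tau> t))"
        by (simp only: infsum_cmult_right' zeta_def mult.assoc)
    qed
    also have "\<dots> = D N (s - \<tau> t) * (Gamma (s - \<tau> t) * Gamma (\<tau> t) * zeta (\<tau> t))"
      by (simp only: infsum_cmult_left' D_def)
    finally show ?thesis by (simp only: mult.assoc)
  qed
  have term_integral: "integral\<^sup>L lborel (f (m, k))
      = 2 * of_real pi * Gamma s * (of_nat (A m N) * of_nat (m + k) powr (- s))" if "(m, k) \<in> I" for m k
  proof -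
    have "integral\<^sup>L lborel (B m k) = 2 * of_real pi * Gamma s * of_real (real m + real k) powr (- s)"
      using Mellin_Barnes_integral [OF pos [OF that] c] by (simp only: B_def [abs_def] \<tau>_def)
    then show ?thesis by (simp add: f_def)
  qed
  have "(\<Sum>\<^sub>\<infinity>i\<in>I. integral\<^sup>L lborel (f i))
      = (\<Sum>\<^sub>\<infinity>(m, k)\<in>I. 2 * of_real pi * Gamma s * (of_nat (A m N) * of_nat (m + k) powr (- s)))"
    by (rule infsum_cong) (clarsimp simp: term_integral simp del: of_nat_add)
  also have "\<dots> = 2 * of_real pi * Gamma s * D (N + 1) s"
    unfolding D_Suc_eq_double_sum [OF assms] I_def case_prod_unfold by (rule infsum_cmult_right')
  finally have "has_bochner_integral lborel
      (\<lambda>t. D N (s - \<tau> t) * Gamma (s - \<tau> t) * Gamma (\<tau> t) * zeta (\<tau> t))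
      (2 * of_real pi * Gamma s * D (N + 1) s)"
    using main by (simp only: integrand)
  then have line: "has_bochner_integral lborel
      (\<lambda>t. D N (s - \<tau> t) * Gamma (s - \<tau> t) * Gamma (\<tau> t) * zeta (\<tau> t) * \<i>)
      (2 * of_real pi * Gamma s * D (N + 1) s * \<i>)"
    by (rule has_bochner_integral_mult_left)
  have "Gamma s \<noteq> 0"
    using c by (intro Gamma_nonzero) (auto elim!: nonpos_Ints_cases simp: complex_eq_iff)
  moreover have "vline_integral c (\<lambda>\<tau>. D N (s - \<tau>) * Gamma (s - \<tau>) * Gamma \<tau> * zeta \<tau>)
      = 2 * of_real pi * Gamma s * D (N + 1) s * \<i>"
    using line by (simp only: vline_integral_def has_bochner_integral_iff \<tau>_def)
  moreover have "vline_integrable c (\<lambda>\<tau>. D N (s - \<tau>) * Gamma (s - \<tau>) * Gamma \<tau> * zeta \<tau>)"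
    using line by (simp only: vline_integrable_def has_bochner_integral_iff \<tau>_def)
  ultimately show ?thesis
    by (simp add: field_simps)
qed

end
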